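(* Let $m\geq 1$ be an integer and let $\Phi_C : M_3\to M_3$ be the Choi map, defined for $X=(x_{i,j})\in M_3$ by \[ \Phi_C(X)=\begin{bmatrix} x_{1,1}+x_{2,2} & -x_{1,2} & -x_{1,3}\\ -x_{2,1} & x_{2,2}+x_{3,3} & -x_{2,3}\\ -x_{3,1} & -x_{3,2} & x_{3,3}+x_{1,1}\end{bmatrix}. \] Then \[ \nu_m(\Phi_C)=\nu_m(\Phi_C^* )\leq \left\lceil \frac{5m}{3}\right\rceil -1 \quad\text{and}\quad \nu(\Phi_C)=\nu(\Phi_C^* )\leq 5/3. \]
   Context: $M_n$ is the set of $n\times n$ complex matrices. A density matrix is a positive semidefinite matrix with trace $1$. $A\succeq O$ means that $A$ is positive semidefinite. The support of a Hermitian matrix is its range. $I_m\otimes\Phi$ acts as the identity map on $M_m$ tensored with $\Phi$. A linear map on $M_n$ is Hermiticity-preserving if it sends Hermitian matrices to Hermitian matrices; the adjoint $\Phi^*$ is defined by $\mathrm{Tr}(X\Phi(Y))=\mathrm{Tr}(\Phi^*(X)Y)$ for all Hermitian $X,Y$. For a Hermiticity-preserving linear map $\Phi$ on $M_n$, $\nu_m(\Phi)$ is the maximum of $\dim(\mathcal{S})$ over all subspaces $\mathcal{S}\subseteq\mathbb{C}^m\otimes\mathbb{C}^n$ such that $(I_m\otimes\Phi)(\rho)\not\succeq O$ for every density matrix $\rho\in M_m\otimes M_n$ with support contained in $\mathcal{S}$; and $\nu(\Phi)=\lim_{m\to\infty}\nu_m(\Phi)/m$ (this limit always exists). *)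

theory Defs
  imports
    Complex_Main
    "HOL-Library.FuncSet"
    "Jordan_Normal_Form.VS_Connect"
    "Jordan_Normal_Form.Schur_Decomposition"
begin

definition hermitian_mat :: "nat \<Rightarrow> complex mat \<Rightarrow> bool" where
  "hermitian_mat n A \<longleftrightarrow> A \<in> carrier_mat n n \<and> mat_adjoint A = A"

text \<open>The order on the complex numbers is the one of \<open>HOL-Library.Complex_Order\<close>:
  \<open>0 \<le> z\<close> says that \<open>z\<close> is a nonnegative real.\<close>

definition positive_semidefinite :: "nat \<Rightarrow> complex mat \<Rightarrow> bool" where
  "positive_semidefinite n A \<longleftrightarrow>
     hermitian_mat n A \<and> (\<forall>v \<in> carrier_vec n. 0 \<le> (A *\<^sub>v v) \<bullet>c v)"

definition mat_trace :: "complex mat \<Rightarrow> complex" where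
  "mat_trace A = (\<Sum>i<dim_row A. A $$ (i, i))"

definition density_mat :: "nat \<Rightarrow> complex mat \<Rightarrow> bool" where
  "density_mat n \<rho> \<longleftrightarrow> positive_semidefinite n \<rho> \<and> mat_trace \<rho> = 1"

definition mat_support :: "complex mat \<Rightarrow> complex vec set" where
  "mat_support A = (\<lambda>v. A *\<^sub>v v) ` carrier_vec (dim_col A)"

abbreviation complex_space :: "nat \<Rightarrow> (complex, complex vec) module" where
  "complex_space d \<equiv> module_vec TYPE(complex) d"

abbreviation matrix_space :: "nat \<Rightarrow> (complex, complex mat) module" where
  "matrix_space n \<equiv> module_mat TYPE(complex) n n"

definition subspace_dim :: "nat \<Rightarrow> complex vec set \<Rightarrow> nat" where
  "subspace_dim d S = vectorspace.dim class_ring ((complex_space d)\<lparr>carrier := S\<rparr>)"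

definition linear_mat_map :: "nat \<Rightarrow> (complex mat \<Rightarrow> complex mat) \<Rightarrow> bool" where
  "linear_mat_map n \<Phi> \<longleftrightarrow> linear_map class_ring (matrix_space n) (matrix_space n) \<Phi>"

definition hermiticity_preserving :: "nat \<Rightarrow> (complex mat \<Rightarrow> complex mat) \<Rightarrow> bool" where
  "hermiticity_preserving n \<Phi> \<longleftrightarrow>
     linear_mat_map n \<Phi> \<and> (\<forall>A. hermitian_mat n A \<longrightarrow> hermitian_mat n (\<Phi> A))"

text \<open>The defining trace identity determines the adjoint on \<open>n \<times> n\<close> matrices only;
  \<open>extensional\<close> fixes its value elsewhere, so that the description is unique.\<close>

definition adjoint_map ::
    "nat \<Rightarrow> (complex mat \<Rightarrow> complex mat) \<Rightarrow> complex mat \<Rightarrow> complex mat" where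
  "adjoint_map n \<Phi> = (THE \<Psi>.
     linear_mat_map n \<Psi> \<and> \<Psi> \<in> extensional (carrier_mat n n) \<and>
     (\<forall>X Y. hermitian_mat n X \<longrightarrow> hermitian_mat n Y \<longrightarrow>
        mat_trace (X * \<Phi> Y) = mat_trace (\<Psi> X * Y)))"

text \<open>The tensor product of \<open>m\<close>-dimensional and \<open>n\<close>-dimensional space is identified with
  the space of dimension \<open>m * n\<close> by sending the tensor product of the basis vectors number
  \<open>i\<close> and \<open>a\<close> to the basis vector number \<open>i * n + a\<close>. A matrix on it is an \<open>m \<times> m\<close> array
  of \<open>n \<times> n\<close> blocks, and the identity tensored with \<open>\<Phi>\<close> applies \<open>\<Phi>\<close> to each block.\<close>

definition tensor_block :: "nat \<Rightarrow> complex mat \<Rightarrow> nat \<Rightarrow> nat \<Rightarrow> complex mat" where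
  "tensor_block n X i j = mat n n (\<lambda>(a, b). X $$ (i * n + a, j * n + b))"

definition id_tensor ::
    "nat \<Rightarrow> nat \<Rightarrow> (complex mat \<Rightarrow> complex mat) \<Rightarrow> complex mat \<Rightarrow> complex mat" where
  "id_tensor m n \<Phi> X = mat (m * n) (m * n)
     (\<lambda>(r, c). \<Phi> (tensor_block n X (r div n) (c div n)) $$ (r mod n, c mod n))"

definition tensor_mat :: "nat \<Rightarrow> nat \<Rightarrow> complex mat \<Rightarrow> complex mat \<Rightarrow> complex mat" where
  "tensor_mat m n A B = mat (m * n) (m * n)
     (\<lambda>(r, c). A $$ (r div n, c div n) * B $$ (r mod n, c mod n))"

lemma id_tensor_tensor_mat:
  assumes lin: "linear_mat_map n \<Phi>" and A: "A \<in> carrier_mat m m" and B: "B \<in> carrier_mat n n"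
  shows "id_tensor m n \<Phi> (tensor_mat m n A B) = tensor_mat m n A (\<Phi> B)"
proof -
  interpret linear_map class_ring "matrix_space n" "matrix_space n" \<Phi>
    using lin unfolding linear_mat_map_def .
  have \<Phi>B: "\<Phi> B \<in> carrier_mat n n"
    using f_im B by (auto simp: module_mat_def)
  have scale: "\<Phi> (c \<cdot>\<^sub>m B) = c \<cdot>\<^sub>m \<Phi> B" for c
    using f_smult[of c B] B by (simp add: module_mat_def)
  have idx: "i * n + a < m * n" if "i < m" "a < n" for i a
  proof -
    have "i * n + a < Suc i * n" using that by simp
    also have "\<dots> \<le> m * n" using that by (intro mult_le_mono1) simp
    finally show ?thesis .
  qed
  have block: "tensor_block n (tensor_mat m n A B) i j = A $$ (i, j) \<cdot>\<^sub>m B"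
    if "i < m" "j < m" for i j
    using B that by (intro eq_matI) (auto simp: tensor_block_def tensor_mat_def idx)
  show ?thesis
  proof (intro eq_matI)
    fix r c
    assume "r < dim_row (tensor_mat m n A (\<Phi> B))" "c < dim_col (tensor_mat m n A (\<Phi> B))"
    then have rc: "r < m * n" "c < m * n" by (simp_all add: tensor_mat_def)
    then have n: "n > 0" by (cases n) auto
    have "r div n < m" "c div n < m"
      using rc by (simp_all add: less_mult_imp_div_less)
    then show "id_tensor m n \<Phi> (tensor_mat m n A B) $$ (r, c)
        = tensor_mat m n A (\<Phi> B) $$ (r, c)"
      using rc n \<Phi>B by (simp add: id_tensor_def block scale) (simp add: tensor_mat_def)
  qed (simp_all add: id_tensor_def tensor_mat_def)
qed

text \<open>The maximum is over a set of naturals bounded by \<open>m * n\<close> that contains \<open>0\<close>, since no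
  density matrix is supported in the zero subspace.\<close>

definition nu_at :: "nat \<Rightarrow> nat \<Rightarrow> (complex mat \<Rightarrow> complex mat) \<Rightarrow> nat" where
  "nu_at n m \<Phi> = Max {subspace_dim (m * n) S | S.
     VectorSpace.subspace class_ring S (complex_space (m * n)) \<and>
     (\<forall>\<rho>. density_mat (m * n) \<rho> \<and> mat_support \<rho> \<subseteq> S \<longrightarrow>
        \<not> positive_semidefinite (m * n) (id_tensor m n \<Phi> \<rho>))}"

definition nu :: "nat \<Rightarrow> (complex mat \<Rightarrow> complex mat) \<Rightarrow> real" where
  "nu n \<Phi> = lim (\<lambda>m. real (nu_at n m \<Phi>) / real m)"

definition choi_map :: "complex mat \<Rightarrow> complex mat" where
  "choi_map X = mat_of_rows_list 3
     [[X $$ (0,0) + X $$ (1,1), - (X $$ (0,1)), - (X $$ (0,2))],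
      [- (X $$ (1,0)), X $$ (1,1) + X $$ (2,2), - (X $$ (1,2))],
      [- (X $$ (2,0)), - (X $$ (2,1)), X $$ (2,2) + X $$ (0,0)]]"

lemma choi_map_hermiticity_preserving: "hermiticity_preserving 3 choi_map"
proof -
  have dims [simp]: "dim_row (choi_map X) = 3" "dim_col (choi_map X) = 3" for X
    by (simp_all add: choi_map_def mat_of_rows_list_def)
  have carr: "choi_map X \<in> carrier_mat 3 3" for X
    by (rule carrier_matI) simp_all
  have less3: "i < 3 \<longleftrightarrow> i = 0 \<or> i = 1 \<or> i = 2" for i :: nat
    by auto
  have entry: "choi_map X $$ (i, j) =
      (if i = j then X $$ (i, i) + X $$ ((i + 1) mod 3, (i + 1) mod 3) else - (X $$ (i, j)))"
    if "i < 3" "j < 3" for X i j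
    using that unfolding less3 by (elim disjE) (simp_all add: choi_map_def mat_of_rows_list_def numeral_2_eq_2)
  have add: "choi_map (X + Y) = choi_map X + choi_map Y"
    if "X \<in> carrier_mat 3 3" "Y \<in> carrier_mat 3 3" for X Y
    using that by (intro eq_matI) (simp_all add: entry)
  have smult: "choi_map (c \<cdot>\<^sub>m X) = c \<cdot>\<^sub>m choi_map X" if "X \<in> carrier_mat 3 3" for c X
    using that by (intro eq_matI) (simp_all add: entry algebra_simps)
  interpret V: vectorspace class_ring "matrix_space 3"
    by (rule matrix_vs)
  have lin: "linear_mat_map 3 choi_map"
    unfolding linear_mat_map_def
    by unfold_locales
      (auto simp: LinearCombinations.module_hom_def module_mat_def add smult carr)
  have herm_iff: "hermitian_mat 3 A \<longleftrightarrow>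
      A \<in> carrier_mat 3 3 \<and> (\<forall>i<3. \<forall>j<3. A $$ (i, j) = cnj (A $$ (j, i)))" for A
  proof (cases "A \<in> carrier_mat 3 3")
    case True
    then have "mat_adjoint A \<in> carrier_mat 3 3"
      and "\<And>i j. i < 3 \<Longrightarrow> j < 3 \<Longrightarrow> mat_adjoint A $$ (i, j) = cnj (A $$ (j, i))"
      by (auto simp: mat_adjoint_def mat_of_rows_def)
    with True show ?thesis
      unfolding hermitian_mat_def mat_eq_iff
      by (metis (no_types, lifting) carrier_matD)
  qed (simp add: hermitian_mat_def)
  have "hermitian_mat 3 (choi_map A)" if "hermitian_mat 3 A" for A
  proof -
    have h: "cnj (A $$ (j, i)) = A $$ (i, j)" if "i < 3" "j < 3" for i j
      using \<open>hermitian_mat 3 A\<close> that herm_iff by metis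
    show ?thesis
      unfolding herm_iff using carr by (auto simp: entry h)
  qed
  with lin show ?thesis
    by (simp add: hermiticity_preserving_def)
qed

end

theory Submission
  imports Defs
begin

text \<open>The bound obtained is in fact \<open>\<nu>\<^sub>m \<le> m\<close>, and \<open>m + 1 \<le> \<lceil>5m/3\<rceil>\<close>. If \<open>dim S > m\<close>, then \<open>S\<close>
  contains a nonzero vector \<open>v\<close> whose third components (one for each of the \<open>m\<close> blocks) all
  vanish. For \<open>\<rho> = v v\<^sup>*\<close> the image under the Choi map is positive semidefinite: restricted to the
  first two coordinates, the Choi map only flips a sign that a diagonal unitary undoes, and adds
  positive diagonal terms.

  The adjoint of the Choi map is the Choi map conjugated by the transposition of the first and the
  third coordinate, which gives the equalities. The limit exists by Fekete's argument: if \<open>S\<^sub>1\<close>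
  and \<open>S\<^sub>2\<close> are admissible for \<open>m\<close> and \<open>k\<close>, then \<open>S\<^sub>1 \<oplus> S\<^sub>2\<close> is admissible for \<open>m + k\<close>, as the
  diagonal compressions of an offending \<open>\<rho>\<close> would have to vanish.\<close>

section \<open>Subspaces and reindexing of coordinates\<close>

text \<open>Pullback of coordinates along \<open>g\<close>: depending on \<open>g\<close> this is a
  permutation of coordinates, the projection to some of the blocks, or the selection of one
  coordinate per block.\<close>

definition reindex_vec :: "nat \<Rightarrow> (nat \<Rightarrow> nat) \<Rightarrow> complex vec \<Rightarrow> complex vec" where
  "reindex_vec d g v = vec d (\<lambda>i. v $ g i)"

abbreviation complex_subspace :: "nat \<Rightarrow> complex vec set \<Rightarrow> bool" where
  "complex_subspace d S \<equiv> VectorSpace.subspace class_ring S (complex_space d)"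

lemma complex_subspace_iff:
  "complex_subspace d S \<longleftrightarrow> S \<subseteq> carrier_vec d \<and> 0\<^sub>v d \<in> S \<and>
     (\<forall>v\<in>S. \<forall>w\<in>S. v + w \<in> S) \<and> (\<forall>c. \<forall>v\<in>S. c \<cdot>\<^sub>v v \<in> S)"
  unfolding VectorSpace.subspace_def LinearCombinations.submodule_def
  using vec_vs[of d, where ?'a = complex] vec_module[of d, where ?'a = complex]
  by (auto simp: module_vec_simps class_ring_simps)

text \<open>A linearly independent subset of \<open>S\<close> is also independent in the ambient
  space and so has at most \<open>d\<close> elements; hence a maximal one exists, and it is a
  basis.\<close>

lemma subspace_fin_dim:
  assumes "complex_subspace d S"
  shows "vectorspace.fin_dim class_ring ((complex_space d)\<lparr>carrier := S\<rparr>)"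
proof -
  interpret V: vec_space "TYPE(complex)" d .
  have vs: "vectorspace class_ring ((complex_space d)\<lparr>carrier := S\<rparr>)"
    using V.subspace_is_vs assms by blast
  interpret S: vectorspace class_ring "(complex_space d)\<lparr>carrier := S\<rparr>"
    by (fact vs)
  have sub: "S \<subseteq> carrier_vec d" and smod: "LinearCombinations.submodule class_ring S (complex_space d)"
    using assms complex_subspace_iff by (auto simp: VectorSpace.subspace_def)
  have small: "finite A \<and> card A \<le> d" if "A \<subseteq> S \<and> S.lin_indpt A" for A
  proof -
    have "V.lin_indpt A"
      using V.span_li_not_depend(2)[OF _ smod] that by auto
    then show ?thesis
      using V.li_le_dim[of A] that sub V.dim_is_n by auto
  qed
  have "\<exists>A. finite A \<and> maximal A (\<lambda>A. A \<subseteq> carrier ((complex_space d)\<lparr>carrier := S\<rparr>) \<and> S.lin_indpt A)"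
    using small by (intro maximal_exists[where N = d and B = "{}"]) (auto simp: S.lin_dep_def)
  then obtain A where "finite A" "S.basis A"
    using S.max_li_is_basis by blast
  then show ?thesis
    unfolding S.fin_dim_def S.basis_def by blast
qed

lemma subspace_dim_zero: "subspace_dim d {0\<^sub>v d} = 0"
proof -
  interpret V: vec_space "TYPE(complex)" d .
  have "complex_subspace d {0\<^sub>v d}"
    by (auto simp: complex_subspace_iff)
  then have vs: "vectorspace class_ring ((complex_space d)\<lparr>carrier := {0\<^sub>v d}\<rparr>)"
    using V.subspace_is_vs by blast
  interpret S: vectorspace class_ring "(complex_space d)\<lparr>carrier := {0\<^sub>v d}\<rparr>"
    by (fact vs)
  have "S.span {} = carrier ((complex_space d)\<lparr>carrier := {0\<^sub>v d}\<rparr>)"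
    using S.span_empty by (simp add: module_vec_simps)
  then show ?thesis
    unfolding subspace_dim_def using S.gen_ge_dim[of "{}"] by simp
qed

text \<open>Rank-nullity for the restriction of a coordinate selection to \<open>S\<close>; the
  dimension counts for admissible subspaces come from it.\<close>

lemma subspace_rank_nullity:
  assumes S: "complex_subspace d S" and g: "\<And>i. i < e \<Longrightarrow> g i < d"
  shows "complex_subspace e (reindex_vec e g ` S)"
    and "complex_subspace d {v \<in> S. reindex_vec e g v = 0\<^sub>v e}"
    and "subspace_dim e (reindex_vec e g ` S) + subspace_dim d {v \<in> S. reindex_vec e g v = 0\<^sub>v e}
         = subspace_dim d S"
proof -
  interpret V: vec_space "TYPE(complex)" d .
  interpret W: vec_space "TYPE(complex)" e .
  have vs: "vectorspace class_ring ((complex_space d)\<lparr>carrier := S\<rparr>)"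
    using V.subspace_is_vs S by blast
  interpret S: vectorspace class_ring "(complex_space d)\<lparr>carrier := S\<rparr>"
    by (fact vs)
  have sub: "S \<subseteq> carrier_vec d"
    using S complex_subspace_iff by auto
  have lin: "linear_map class_ring ((complex_space d)\<lparr>carrier := S\<rparr>) (complex_space e) (reindex_vec e g)"
  proof (unfold_locales)
    show "reindex_vec e g \<in> LinearCombinations.module_hom class_ring
        ((complex_space d)\<lparr>carrier := S\<rparr>) (complex_space e)"
      unfolding LinearCombinations.module_hom_def
    proof (intro CollectI conjI allI impI)
      show "reindex_vec e g \<in> carrier ((complex_space d)\<lparr>carrier := S\<rparr>) \<rightarrow> carrier (complex_space e)"
        by (auto simp: module_vec_simps reindex_vec_def)
    qed (use sub g in \<open>auto simp: module_vec_simps reindex_vec_def subset_iff intro!: eq_vecI\<close>)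
  qed
  interpret L: linear_map class_ring "(complex_space d)\<lparr>carrier := S\<rparr>" "complex_space e" "reindex_vec e g"
    by (fact lin)
  have im: "L.imT = reindex_vec e g ` S"
    by (simp add: L.im_def)
  have ker: "L.kerT = {v \<in> S. reindex_vec e g v = 0\<^sub>v e}"
    by (simp add: L.ker_def module_vec_simps)
  show "complex_subspace e (reindex_vec e g ` S)"
    using L.imT_is_subspace im by simp
  show "complex_subspace d {v \<in> S. reindex_vec e g v = 0\<^sub>v e}"
  proof -
    have zero_iff: "reindex_vec e g v = 0\<^sub>v e \<longleftrightarrow> (\<forall>i<e. v $ g i = 0)" for v
      by (auto simp: reindex_vec_def vec_eq_iff)
    show ?thesis
      using S g sub unfolding complex_subspace_iff zero_iff by (auto simp: subset_iff)
  qed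
  show "subspace_dim e (reindex_vec e g ` S) + subspace_dim d {v \<in> S. reindex_vec e g v = 0\<^sub>v e}
         = subspace_dim d S"
    using L.rank_nullity[OF subspace_fin_dim[OF S]] im ker
    unfolding subspace_dim_def by simp
qed

text \<open>A basis of \<open>S\<close> is independent in the ambient space. The bound makes the set
  of dimensions in \<open>nu_at\<close> finite.\<close>

lemma subspace_dim_le:
  assumes "complex_subspace d S"
  shows "subspace_dim d S \<le> d"
proof -
  interpret V: vec_space "TYPE(complex)" d .
  have vs: "vectorspace class_ring ((complex_space d)\<lparr>carrier := S\<rparr>)"
    using V.subspace_is_vs assms by blast
  interpret S: vectorspace class_ring "(complex_space d)\<lparr>carrier := S\<rparr>"
    by (fact vs)
  have sub: "S \<subseteq> carrier_vec d" and smod: "LinearCombinations.submodule class_ring S (complex_space d)"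
    using assms complex_subspace_iff by (auto simp: VectorSpace.subspace_def)
  obtain A where A: "finite A" "S.basis A"
    using S.finite_basis_exists[OF subspace_fin_dim[OF assms]] by blast
  then have "V.lin_indpt A" "A \<subseteq> S"
    using V.span_li_not_depend(2)[OF _ smod] by (auto simp: S.basis_def)
  then have "card A \<le> d"
    using V.li_le_dim[of A] sub V.dim_is_n by auto
  then show ?thesis
    using S.dim_basis[OF A] by (simp add: subspace_dim_def)
qed

section \<open>Positive semidefinite matrices\<close>

text \<open>For injective \<open>g\<close> a principal submatrix with rows and columns rearranged;
  for a permutation, conjugation by a permutation matrix.\<close>

definition reindex_mat :: "nat \<Rightarrow> (nat \<Rightarrow> nat) \<Rightarrow> complex mat \<Rightarrow> complex mat" where
  "reindex_mat d g A = mat d d (\<lambda>(i, j). A $$ (g i, g j))"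

lemma reindex_mat_carrier [simp]: "reindex_mat d g A \<in> carrier_mat d d"
  by (simp add: reindex_mat_def)

lemma hermitian_mat_iff:
  "hermitian_mat n A \<longleftrightarrow>
     A \<in> carrier_mat n n \<and> (\<forall>i<n. \<forall>j<n. cnj (A $$ (j, i)) = A $$ (i, j))"
proof (cases "A \<in> carrier_mat n n")
  case True
  then have "mat_adjoint A \<in> carrier_mat n n"
    and "\<And>i j. i < n \<Longrightarrow> j < n \<Longrightarrow> mat_adjoint A $$ (i, j) = cnj (A $$ (j, i))"
    by (auto simp: mat_adjoint_def mat_of_rows_def)
  with True show ?thesis
    unfolding hermitian_mat_def mat_eq_iff
    by (metis (no_types, lifting) carrier_matD)
qed (simp add: hermitian_mat_def)

text \<open>The test vector becomes an arbitrary function on indices, so that it can be composed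
  with index maps and extended by zero without carrier conditions.\<close>

lemma positive_semidefinite_iff:
  "positive_semidefinite n A \<longleftrightarrow> hermitian_mat n A \<and>
     (\<forall>f. 0 \<le> (\<Sum>i<n. \<Sum>j<n. A $$ (i, j) * f j * cnj (f i)))"
proof -
  have form: "(A *\<^sub>v v) \<bullet>c v = (\<Sum>i<n. \<Sum>j<n. A $$ (i, j) * v $ j * cnj (v $ i))"
    if "A \<in> carrier_mat n n" "v \<in> carrier_vec n" for v
    using that by (auto simp: scalar_prod_def lessThan_atLeast0 sum_distrib_right intro!: sum.cong)
  have "(\<forall>v\<in>carrier_vec n. 0 \<le> (\<Sum>i<n. \<Sum>j<n. A $$ (i, j) * v $ j * cnj (v $ i)))
    \<longleftrightarrow> (\<forall>f. 0 \<le> (\<Sum>i<n. \<Sum>j<n. A $$ (i, j) * f j * cnj (f i)))" (is "?L \<longleftrightarrow> ?R")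
  proof
    assume L: ?L
    show ?R
    proof
      fix f :: "nat \<Rightarrow> complex"
      show "0 \<le> (\<Sum>i<n. \<Sum>j<n. A $$ (i, j) * f j * cnj (f i))"
        using L[rule_format, of "vec n f"] by simp
    qed
  qed simp
  then show ?thesis
    unfolding positive_semidefinite_def hermitian_mat_def using form by auto
qed

text \<open>Transfers sums between the small and the large index range, for quadratic forms and
  matrix-vector products of compressions.\<close>

lemma sum_extend_by_zero:
  fixes F' :: "nat \<Rightarrow> 'a::comm_monoid_add"
  assumes g: "inj_on g {..<d}" "g ` {..<d} \<subseteq> {..<D}"
    and zero: "\<And>r. r \<notin> g ` {..<d} \<Longrightarrow> F' r = 0"
  shows "(\<Sum>r<D. F' r) = (\<Sum>i<d. F' (g i))"
proof -
  have "(\<Sum>r<D. F' r) = (\<Sum>r\<in>g ` {..<d}. F' r)"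
    using assms by (intro sum.mono_neutral_right) auto
  also have "\<dots> = (\<Sum>i<d. F' (g i))"
    using g by (simp add: sum.reindex)
  finally show ?thesis .
qed

text \<open>The form of the compression at \<open>f\<close> is the form of \<open>A\<close> at the
  extension of \<open>f\<close> by zero along \<open>g\<close>.\<close>

lemma positive_semidefinite_reindex:
  assumes g: "inj_on g {..<d}" "g ` {..<d} \<subseteq> {..<D}" and A: "positive_semidefinite D A"
  shows "positive_semidefinite d (reindex_mat d g A)"
  unfolding positive_semidefinite_iff
proof (intro conjI allI)
  show "hermitian_mat d (reindex_mat d g A)"
    using g A by (auto simp: positive_semidefinite_iff hermitian_mat_iff reindex_mat_def image_subset_iff)
  fix f :: "nat \<Rightarrow> complex"
  define f' where "f' r = (if r \<in> g ` {..<d} then f (inv_into {..<d} g r) else 0)" for r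
  have f'_g: "f' (g i) = f i" if "i < d" for i
    using that g by (simp add: f'_def)
  have f'_zero: "f' r = 0" if "r \<notin> g ` {..<d}" for r
    using that by (simp add: f'_def)
  have "0 \<le> (\<Sum>r<D. \<Sum>s<D. A $$ (r, s) * f' s * cnj (f' r))"
    using A by (simp add: positive_semidefinite_iff)
  also have "\<dots> = (\<Sum>i<d. \<Sum>s<D. A $$ (g i, s) * f' s * cnj (f' (g i)))"
    by (intro sum_extend_by_zero g) (simp add: f'_zero)
  also have "\<dots> = (\<Sum>i<d. \<Sum>j<d. A $$ (g i, g j) * f' (g j) * cnj (f' (g i)))"
    by (intro sum.cong sum_extend_by_zero g) (auto simp: f'_zero)
  also have "\<dots> = (\<Sum>i<d. \<Sum>j<d. reindex_mat d g A $$ (i, j) * f j * cnj (f i))"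
    by (intro sum.cong) (auto simp: f'_g reindex_mat_def)
  finally show "0 \<le> (\<Sum>i<d. \<Sum>j<d. reindex_mat d g A $$ (i, j) * f j * cnj (f i))" .
qed

text \<open>If \<open>P\<close> selects the coordinates \<open>g i\<close>, then the compression is
  \<open>P A P*\<close>, and \<open>P A P* w\<close> is the image under \<open>P\<close> of a vector
  in the range of \<open>A\<close>.\<close>

lemma mat_support_reindex:
  assumes g: "inj_on g {..<d}" "g ` {..<d} \<subseteq> {..<D}" and A: "A \<in> carrier_mat D D"
  shows "mat_support (reindex_mat d g A) \<subseteq> reindex_vec d g ` mat_support A"
proof
  fix x assume "x \<in> mat_support (reindex_mat d g A)"
  then obtain w where w: "w \<in> carrier_vec d" and x: "x = reindex_mat d g A *\<^sub>v w"
    by (auto simp: mat_support_def reindex_mat_def)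
  define w' where "w' = vec D (\<lambda>r. if r \<in> g ` {..<d} then w $ inv_into {..<d} g r else 0)"
  have "x = reindex_vec d g (A *\<^sub>v w')"
  proof (intro eq_vecI)
    fix i assume "i < dim_vec (reindex_vec d g (A *\<^sub>v w'))"
    then have i: "i < d" "g i < D"
      using g by (auto simp: reindex_vec_def)
    have "(A *\<^sub>v w') $ g i = (\<Sum>s<D. A $$ (g i, s) *
        (if s \<in> g ` {..<d} then w $ inv_into {..<d} g s else 0))"
      using A i by (auto simp: scalar_prod_def w'_def lessThan_atLeast0 intro!: sum.cong)
    also have "\<dots> = (\<Sum>j<d. A $$ (g i, g j) *
        (if g j \<in> g ` {..<d} then w $ inv_into {..<d} g (g j) else 0))"
      by (intro sum_extend_by_zero g) simp
    also have "\<dots> = x $ i"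
      using i w g unfolding x
      by (auto simp: scalar_prod_def reindex_mat_def lessThan_atLeast0 intro!: sum.cong)
    finally show "x $ i = reindex_vec d g (A *\<^sub>v w') $ i"
      using i by (simp add: reindex_vec_def)
  qed (simp add: x reindex_vec_def reindex_mat_def)
  moreover have "w' \<in> carrier_vec (dim_col A)"
    using A by (simp add: w'_def)
  ultimately show "x \<in> reindex_vec d g ` mat_support A"
    by (auto simp: mat_support_def)
qed

lemma positive_semidefinite_add:
  assumes "positive_semidefinite n A" "positive_semidefinite n B"
  shows "positive_semidefinite n (A + B)"
proof -
  have "hermitian_mat n (A + B)"
    using assms by (auto simp: positive_semidefinite_iff hermitian_mat_iff)
  moreover have "0 \<le> (\<Sum>i<n. \<Sum>j<n. (A + B) $$ (i, j) * f j * cnj (f i))" for f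
  proof -
    have "(\<Sum>i<n. \<Sum>j<n. (A + B) $$ (i, j) * f j * cnj (f i)) =
        (\<Sum>i<n. \<Sum>j<n. A $$ (i, j) * f j * cnj (f i)) + (\<Sum>i<n. \<Sum>j<n. B $$ (i, j) * f j * cnj (f i))"
      using assms unfolding positive_semidefinite_iff hermitian_mat_iff sum.distrib[symmetric]
      by (intro sum.cong) (auto simp: algebra_simps)
    with assms show ?thesis
      by (simp add: positive_semidefinite_iff)
  qed
  ultimately show ?thesis
    by (simp add: positive_semidefinite_iff)
qed

lemma positive_semidefinite_smult:
  assumes A: "positive_semidefinite n A" and c: "0 \<le> c"
  shows "positive_semidefinite n (c \<cdot>\<^sub>m A)"
proof -
  have "cnj c = c"
    using c by (simp add: complex_eq_iff less_eq_complex_def)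
  then have "hermitian_mat n (c \<cdot>\<^sub>m A)"
    using A by (auto simp: positive_semidefinite_iff hermitian_mat_iff)
  moreover have "0 \<le> (\<Sum>i<n. \<Sum>j<n. (c \<cdot>\<^sub>m A) $$ (i, j) * f j * cnj (f i))" for f
  proof -
    have "(\<Sum>i<n. \<Sum>j<n. (c \<cdot>\<^sub>m A) $$ (i, j) * f j * cnj (f i)) =
        c * (\<Sum>i<n. \<Sum>j<n. A $$ (i, j) * f j * cnj (f i))"
      using A unfolding positive_semidefinite_iff hermitian_mat_iff sum_distrib_left
      by (intro sum.cong) (auto simp: algebra_simps)
    with A c show ?thesis
      by (simp add: positive_semidefinite_iff)
  qed
  ultimately show ?thesis
    by (simp add: positive_semidefinite_iff)
qed

text \<open>The form at \<open>f\<close> factors as \<open>z * cnj z\<close>, with \<open>z\<close>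
  the sum of the \<open>u i * cnj (f i)\<close>.\<close>

lemma positive_semidefinite_rank_one:
  "positive_semidefinite n (mat n n (\<lambda>(i, j). u i * cnj (u j)))"
proof -
  have "(\<Sum>i<n. \<Sum>j<n. mat n n (\<lambda>(i, j). u i * cnj (u j)) $$ (i, j) * f j * cnj (f i)) =
      (\<Sum>i<n. u i * cnj (f i)) * cnj (\<Sum>i<n. u i * cnj (f i))" for f
    unfolding cnj_sum sum_product by (intro sum.cong) auto
  moreover have "0 \<le> z * cnj z" for z
    by (simp add: complex_mult_cnj less_eq_complex_def)
  ultimately show ?thesis
    by (simp only: positive_semidefinite_iff) (simp add: hermitian_mat_iff)
qed

lemma positive_semidefinite_trace:
  assumes "positive_semidefinite n A"
  shows "0 \<le> mat_trace A"
proof -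
  have "0 \<le> A $$ (k, k)" if "k < n" for k
  proof -
    \<comment> \<open>Testing with the unit vector number \<open>k\<close> isolates the diagonal
      entry.\<close>
    have "0 \<le> (\<Sum>i<n. \<Sum>j<n. A $$ (i, j) * of_bool (j = k) * cnj (of_bool (i = k)))"
      using assms unfolding positive_semidefinite_iff by (elim conjE allE)
    also have "\<dots> = (\<Sum>i<n. \<Sum>j<n. if i = k then (if j = k then A $$ (i, j) else 0) else 0)"
      by (intro sum.cong) auto
    also have "\<dots> = (\<Sum>i<n. if i = k then A $$ (i, k) else 0)"
      using that by (intro sum.cong) auto
    also have "\<dots> = A $$ (k, k)"
      using that by simp
    finally show ?thesis .
  qed
  with assms show ?thesis
    by (auto simp: mat_trace_def positive_semidefinite_iff hermitian_mat_iff intro!: sum_nonneg)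
qed

section \<open>Linear matrix maps applied blockwise\<close>

lemma linear_mat_map_iff:
  "linear_mat_map n \<Phi> \<longleftrightarrow>
     (\<forall>X\<in>carrier_mat n n. \<Phi> X \<in> carrier_mat n n) \<and>
     (\<forall>X\<in>carrier_mat n n. \<forall>Y\<in>carrier_mat n n. \<Phi> (X + Y) = \<Phi> X + \<Phi> Y) \<and>
     (\<forall>c. \<forall>X\<in>carrier_mat n n. \<Phi> (c \<cdot>\<^sub>m X) = c \<cdot>\<^sub>m \<Phi> X)"
proof -
  have vs: "vectorspace class_ring (matrix_space n)"
    by (rule matrix_vs)
  then have "linear_mat_map n \<Phi> \<longleftrightarrow>
      \<Phi> \<in> LinearCombinations.module_hom class_ring (matrix_space n) (matrix_space n)"
    by (auto simp: linear_mat_map_def linear_map_def mod_hom_def mod_hom_axioms_def vectorspace_def)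
  then show ?thesis
    by (auto simp: LinearCombinations.module_hom_def module_mat_def)
qed

lemma block_index_less:
  fixes i a m n :: nat
  assumes "i < m" "a < n"
  shows "i * n + a < m * n"
proof -
  have "i * n + a < Suc i * n" using assms by simp
  also have "\<dots> \<le> m * n" using assms by (intro mult_le_mono1) simp
  finally show ?thesis .
qed

text \<open>Homogeneity is what allows an offending matrix to be rescaled to trace one.\<close>

lemma id_tensor_smult:
  assumes "linear_mat_map n \<Phi>" and X: "X \<in> carrier_mat (m * n) (m * n)"
  shows "id_tensor m n \<Phi> (c \<cdot>\<^sub>m X) = c \<cdot>\<^sub>m id_tensor m n \<Phi> X"
proof (intro eq_matI)
  fix r s assume "r < dim_row (c \<cdot>\<^sub>m id_tensor m n \<Phi> X)" "s < dim_col (c \<cdot>\<^sub>m id_tensor m n \<Phi> X)"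
  then have rs: "r < m * n" "s < m * n"
    by (simp_all add: id_tensor_def)
  then have n: "n > 0" by (cases n) auto
  have blocks: "r div n < m" "s div n < m"
    using rs by (simp_all add: less_mult_imp_div_less)
  have T: "tensor_block n X i j \<in> carrier_mat n n" for i j
    by (simp add: tensor_block_def)
  have "tensor_block n (c \<cdot>\<^sub>m X) (r div n) (s div n) = c \<cdot>\<^sub>m tensor_block n X (r div n) (s div n)"
    using X blocks by (intro eq_matI) (auto simp: tensor_block_def block_index_less)
  then have "\<Phi> (tensor_block n (c \<cdot>\<^sub>m X) (r div n) (s div n))
      = c \<cdot>\<^sub>m \<Phi> (tensor_block n X (r div n) (s div n))"
    using assms(1) T by (simp add: linear_mat_map_iff)
  moreover have "\<Phi> (tensor_block n X (r div n) (s div n)) \<in> carrier_mat n n"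
    using assms(1) T by (simp add: linear_mat_map_iff)
  ultimately show "id_tensor m n \<Phi> (c \<cdot>\<^sub>m X) $$ (r, s) = (c \<cdot>\<^sub>m id_tensor m n \<Phi> X) $$ (r, s)"
    using rs n by (simp add: id_tensor_def)
qed (simp_all add: id_tensor_def)

text \<open>Permutations inside the blocks and compressions to block diagonal positions are both reindexings by
  \<open>i * n + a \<mapsto> h i * n + \<pi> a\<close>.\<close>

definition block_index :: "nat \<Rightarrow> (nat \<Rightarrow> nat) \<Rightarrow> (nat \<Rightarrow> nat) \<Rightarrow> nat \<Rightarrow> nat" where
  "block_index n h \<pi> r = h (r div n) * n + \<pi> (r mod n)"

lemma block_index_image:
  assumes "h ` {..<m} \<subseteq> {..<M}" "\<pi> ` {..<n} \<subseteq> {..<n}"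
  shows "block_index n h \<pi> ` {..<m * n} \<subseteq> {..<M * n}"
proof -
  have "block_index n h \<pi> r < M * n" if r: "r < m * n" for r
  proof -
    have "n > 0" using r by (cases n) auto
    then show ?thesis
      using assms r unfolding block_index_def
      by (intro block_index_less) (auto simp: image_subset_iff less_mult_imp_div_less)
  qed
  then show ?thesis by auto
qed

lemma block_index_inj:
  assumes h: "inj_on h {..<m}" and \<pi>: "inj_on \<pi> {..<n}" "\<pi> ` {..<n} \<subseteq> {..<n}"
  shows "inj_on (block_index n h \<pi>) {..<m * n}"
proof (intro inj_onI)
  fix r s assume rs: "r \<in> {..<m * n}" "s \<in> {..<m * n}" and eq: "block_index n h \<pi> r = block_index n h \<pi> s"
  then have n: "n > 0" by (cases n) auto
  have lt: "\<pi> (r mod n) < n" "\<pi> (s mod n) < n"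
    using \<pi> n by (auto simp: image_subset_iff)
  \<comment> \<open>Division with remainder by \<open>n\<close> recovers the block part and the
    inner part, since the inner part stays below \<open>n\<close>.\<close>
  have "block_index n h \<pi> t div n = h (t div n)" "block_index n h \<pi> t mod n = \<pi> (t mod n)"
    if "\<pi> (t mod n) < n" for t
    using that n by (simp_all add: block_index_def)
  with lt eq have "h (r div n) = h (s div n)" "\<pi> (r mod n) = \<pi> (s mod n)"
    by metis+
  then have "r div n = s div n" "r mod n = s mod n"
    using rs n by (auto intro: inj_onD[OF h] inj_onD[OF \<pi>(1)] simp: less_mult_imp_div_less)
  then show "r = s"
    by (metis div_mult_mod_eq)
qed

text \<open>Selecting blocks by \<open>h\<close> commutes with any blockwise map; inside each block
  the assumption moves \<open>reindex_mat n \<pi>\<close> past the map, exchanging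
  \<open>\<Phi>\<close> for \<open>\<Psi>\<close>.\<close>

lemma id_tensor_reindex:
  assumes h: "h ` {..<m} \<subseteq> {..<M}" and \<pi>: "\<pi> ` {..<n} \<subseteq> {..<n}"
    and \<Phi>: "\<And>Y. Y \<in> carrier_mat n n \<Longrightarrow> \<Psi> (reindex_mat n \<pi> Y) = reindex_mat n \<pi> (\<Phi> Y)"
  shows "id_tensor m n \<Psi> (reindex_mat (m * n) (block_index n h \<pi>) X)
    = reindex_mat (m * n) (block_index n h \<pi>) (id_tensor M n \<Phi> X)"
proof (intro eq_matI)
  let ?g = "block_index n h \<pi>"
  fix r s assume "r < dim_row (reindex_mat (m * n) ?g (id_tensor M n \<Phi> X))"
    "s < dim_col (reindex_mat (m * n) ?g (id_tensor M n \<Phi> X))"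
  then have rs: "r < m * n" "s < m * n"
    by (simp_all add: reindex_mat_def)
  then have n: "n > 0" by (cases n) auto
  have div_mod: "?g t div n = h (t div n)" "?g t mod n = \<pi> (t mod n)" for t
    using \<pi> n by (simp_all add: block_index_def image_subset_iff)
  have lt: "?g r < M * n" "?g s < M * n"
    using block_index_image[OF h \<pi>] rs by auto
  have blocks: "r div n < m" "s div n < m"
    using rs by (simp_all add: less_mult_imp_div_less)
  have "tensor_block n (reindex_mat (m * n) ?g X) (r div n) (s div n)
      = reindex_mat n \<pi> (tensor_block n X (h (r div n)) (h (s div n)))"
    using blocks \<pi> n
    by (intro eq_matI)
      (auto simp: tensor_block_def reindex_mat_def block_index_less block_index_def image_subset_iff)
  then have "\<Psi> (tensor_block n (reindex_mat (m * n) ?g X) (r div n) (s div n))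
      = reindex_mat n \<pi> (\<Phi> (tensor_block n X (h (r div n)) (h (s div n))))"
    using \<Phi> by (simp add: tensor_block_def)
  then show "id_tensor m n \<Psi> (reindex_mat (m * n) ?g X) $$ (r, s)
      = reindex_mat (m * n) ?g (id_tensor M n \<Phi> X) $$ (r, s)"
    using rs lt n by (simp add: id_tensor_def reindex_mat_def div_mod)
qed (simp_all add: id_tensor_def reindex_mat_def)

section \<open>Admissible subspaces\<close>

definition avoids_positive :: "nat \<Rightarrow> nat \<Rightarrow> (complex mat \<Rightarrow> complex mat) \<Rightarrow> complex vec set \<Rightarrow> bool" where
  "avoids_positive n m \<Phi> S \<longleftrightarrow> complex_subspace (m * n) S \<and>
     (\<forall>\<rho>. density_mat (m * n) \<rho> \<and> mat_support \<rho> \<subseteq> S \<longrightarrow>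
        \<not> positive_semidefinite (m * n) (id_tensor m n \<Phi> \<rho>))"

text \<open>A scale-free form of admissibility: were the trace of \<open>X\<close> nonzero, it would
  be positive, and dividing by it would produce a forbidden density matrix. This handles
  compressions of a density matrix, whose trace is not known in advance.\<close>

lemma avoids_positive_trace_zero:
  assumes \<Phi>: "linear_mat_map n \<Phi>" and S: "avoids_positive n m \<Phi> S"
    and X: "positive_semidefinite (m * n) X" "mat_support X \<subseteq> S"
    and pos: "positive_semidefinite (m * n) (id_tensor m n \<Phi> X)"
  shows "mat_trace X = 0"
proof (rule ccontr)
  assume nz: "mat_trace X \<noteq> 0"
  define c where "c = inverse (mat_trace X)"
  have c: "0 \<le> c"
    using positive_semidefinite_trace[OF X(1)] nz
    by (auto simp: c_def less_eq_complex_def complex_is_Real_iff Re_inverse)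
  have carr: "X \<in> carrier_mat (m * n) (m * n)"
    using X by (simp add: positive_semidefinite_iff hermitian_mat_iff)
  have "mat_trace (c \<cdot>\<^sub>m X) = c * mat_trace X"
    using carr by (auto simp: mat_trace_def sum_distrib_left)
  then have "density_mat (m * n) (c \<cdot>\<^sub>m X)"
    using positive_semidefinite_smult[OF X(1) c] nz by (simp add: density_mat_def c_def)
  moreover have "mat_support (c \<cdot>\<^sub>m X) \<subseteq> S"
  proof
    fix x assume "x \<in> mat_support (c \<cdot>\<^sub>m X)"
    then obtain w where w: "w \<in> carrier_vec (m * n)" "x = (c \<cdot>\<^sub>m X) *\<^sub>v w"
      using carr by (auto simp: mat_support_def)
    then have "x = c \<cdot>\<^sub>v (X *\<^sub>v w)"
      using carr by (auto intro!: eq_vecI)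
    moreover have "X *\<^sub>v w \<in> S"
      using X(2) w carr by (auto simp: mat_support_def)
    ultimately show "x \<in> S"
      using S by (simp add: avoids_positive_def complex_subspace_iff)
  qed
  moreover have "positive_semidefinite (m * n) (id_tensor m n \<Phi> (c \<cdot>\<^sub>m X))"
    using positive_semidefinite_smult[OF pos c] id_tensor_smult[OF \<Phi> carr] by simp
  ultimately show False
    using S by (auto simp: avoids_positive_def)
qed

section \<open>Superadditivity\<close>

text \<open>Fekete's lemma: the limit is the supremum of the ratios, finite by the linear bound.
  Nonnegativity allows the remainder term \<open>a (n mod m)\<close> to be dropped.\<close>

lemma superadditive_ratio_limit:
  fixes a :: "nat \<Rightarrow> real"
  assumes super: "\<And>m k. a m + a k \<le> a (m + k)" and nonneg: "\<And>m. 0 \<le> a m"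
    and bound: "\<And>m. a m \<le> C * real m"
  obtains L where "(\<lambda>m. a m / real m) \<longlonglongrightarrow> L" "L \<le> C"
proof -
  \<comment> \<open>The index starts at 1 because the ratio at 0 is only the default value of
    division by zero.\<close>
  define L where "L = (SUP m\<in>{1..}. a m / real m)"
  have le_C: "a m / real m \<le> C" if "m \<ge> 1" for m
    using bound[of m] that by (simp add: field_simps)
  have bdd: "bdd_above ((\<lambda>m. a m / real m) ` {1..})"
    using le_C by (intro bdd_aboveI[of _ C]) auto
  have upper: "a m / real m \<le> L" if "m \<ge> 1" for m
    unfolding L_def using that bdd by (intro cSUP_upper) auto
  have mult: "real q * a m + a r \<le> a (q * m + r)" for q m r
  proof (induction q)
    case (Suc q)
    have "real (Suc q) * a m + a r = a m + (real q * a m + a r)"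
      by (simp add: algebra_simps)
    also have "\<dots> \<le> a m + a (q * m + r)"
      using Suc by simp
    also have "\<dots> \<le> a (Suc q * m + r)"
      using super[of m "q * m + r"] by (simp add: algebra_simps)
    finally show ?case .
  qed simp
  \<comment> \<open>Write \<open>n\<close> as \<open>q * m + r\<close> with \<open>r < m\<close>;
    then \<open>q * m \<ge> n - m\<close>, which costs at most \<open>a m / n\<close> in the ratio.
    For fixed \<open>m\<close> this loss tends to zero.\<close>
  have lower: "a m / real m - a m / real n \<le> a n / real n" if "m \<ge> 1" "n \<ge> 1" for m n
  proof -
    have "real n - real m \<le> real (n div m) * real m"
    proof -
      have "n \<le> n div m * m + m"
        using that div_mult_mod_eq[of n m] mod_less_divisor[of m n] by linarith
      then have "real n \<le> real (n div m * m + m)"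
        by (simp only: of_nat_le_iff)
      then show ?thesis by simp
    qed
    then have "(real n - real m) * (a m / real m) \<le> real (n div m) * real m * (a m / real m)"
      using nonneg[of m] by (intro mult_right_mono) auto
    also have "\<dots> = real (n div m) * a m"
      using that by simp
    also have "\<dots> \<le> a n"
      using mult[of "n div m" m "n mod m"] nonneg[of "n mod m"] by simp
    finally have "(real n - real m) * (a m / real m) / real n \<le> a n / real n"
      by (intro divide_right_mono) auto
    moreover have "(real n - real m) * (a m / real m) / real n = a m / real m - a m / real n"
      using that by (simp add: field_simps)
    ultimately show ?thesis by simp
  qed
  have "(\<lambda>n. a n / real n) \<longlonglongrightarrow> L"
  proof (rule order_tendstoI)
    fix x assume "x < L"
    then obtain m where m: "m \<ge> 1" "x < a m / real m"
      unfolding L_def using bdd by (subst (asm) less_cSUP_iff) auto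
    have "(\<lambda>n. a m / real m - a m / real n) \<longlonglongrightarrow> a m / real m - 0"
      by (intro tendsto_intros lim_const_over_n)
    then have "eventually (\<lambda>n. x < a m / real m - a m / real n) sequentially"
      using m by (intro order_tendstoD(1)) auto
    then show "eventually (\<lambda>n. x < a n / real n) sequentially"
      using eventually_ge_at_top[of 1]
    proof eventually_elim
      case (elim n)
      then show ?case using lower[of m n] m by linarith
    qed
  next
    fix x assume "L < x"
    show "eventually (\<lambda>n. a n / real n < x) sequentially"
      using eventually_ge_at_top[of 1]
    proof eventually_elim
      case (elim n)
      then show ?case using upper[of n] \<open>L < x\<close> by linarith
    qed
  qed
  moreover have "L \<le> C"
    unfolding L_def using le_C by (intro cSUP_least) auto
  ultimately show ?thesis
    by (rule that)
qed

section \<open>Attainment of the maximum\<close>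

text \<open>Support in the zero subspace forces every diagonal entry, hence the trace, to vanish.
  This makes the set of dimensions in \<open>nu_at\<close> nonempty.\<close>

lemma avoids_positive_zero: "avoids_positive n m \<Phi> {0\<^sub>v (m * n)}"
  unfolding avoids_positive_def
proof (intro conjI allI impI)
  show "complex_subspace (m * n) {0\<^sub>v (m * n)}"
    by (auto simp: complex_subspace_iff)
  fix \<rho> assume \<rho>: "density_mat (m * n) \<rho> \<and> mat_support \<rho> \<subseteq> {0\<^sub>v (m * n)}"
  then have carr: "\<rho> \<in> carrier_mat (m * n) (m * n)"
    by (simp add: density_mat_def positive_semidefinite_iff hermitian_mat_iff)
  have "\<rho> $$ (k, k) = 0" if k: "k < m * n" for k
  proof -
    have "\<rho> *\<^sub>v unit_vec (m * n) k \<in> mat_support \<rho>"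
      using carr by (auto simp: mat_support_def)
    then have "\<rho> *\<^sub>v unit_vec (m * n) k = 0\<^sub>v (m * n)"
      using \<rho> by blast
    then have "(\<rho> *\<^sub>v unit_vec (m * n) k) $ k = 0"
      using k by simp
    then show ?thesis
      using k carr by simp
  qed
  then have "mat_trace \<rho> = 0"
    using carr by (simp add: mat_trace_def)
  then show "\<not> positive_semidefinite (m * n) (id_tensor m n \<Phi> \<rho>)"
    using \<rho> by (simp add: density_mat_def)
qed

lemma nu_at_Max:
  "nu_at n m \<Phi> = Max {subspace_dim (m * n) S | S. avoids_positive n m \<Phi> S}"
  by (simp add: nu_at_def avoids_positive_def)

lemma finite_avoids_positive_dims: "finite {subspace_dim (m * n) S | S. avoids_positive n m \<Phi> S}"
  by (rule finite_subset[of _ "{..m * n}"]) (auto simp: avoids_positive_def subspace_dim_le)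

lemma nu_at_attained:
  obtains S where "avoids_positive n m \<Phi> S" "subspace_dim (m * n) S = nu_at n m \<Phi>"
proof -
  have "nu_at n m \<Phi> \<in> {subspace_dim (m * n) S | S. avoids_positive n m \<Phi> S}"
    unfolding nu_at_Max using finite_avoids_positive_dims avoids_positive_zero[of n m \<Phi>]
    by (intro Max_in) blast+
  then show ?thesis
    using that by auto
qed

lemma nu_at_ge: "avoids_positive n m \<Phi> S \<Longrightarrow> subspace_dim (m * n) S \<le> nu_at n m \<Phi>"
  unfolding nu_at_Max using finite_avoids_positive_dims by (intro Max_ge) auto

text \<open>Common core of superadditivity and of invariance under conjugation: reindexing preserves
  positivity of both \<open>\<rho>\<close> and its image, so the compression falls under
  \<open>avoids_positive_trace_zero\<close>. The first use has \<open>\<pi> = id\<close> and an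
  \<open>h\<close> that includes a group of blocks; the second has \<open>h = id\<close>.\<close>

lemma avoids_positive_reindex_trace:
  assumes \<Psi>: "linear_mat_map n \<Psi>" and S: "avoids_positive n m \<Psi> S"
    and h: "inj_on h {..<m}" "h ` {..<m} \<subseteq> {..<M}"
    and \<pi>: "inj_on \<pi> {..<n}" "\<pi> ` {..<n} \<subseteq> {..<n}"
    and \<Phi>: "\<And>Y. Y \<in> carrier_mat n n \<Longrightarrow> \<Psi> (reindex_mat n \<pi> Y) = reindex_mat n \<pi> (\<Phi> Y)"
    and \<rho>: "positive_semidefinite (M * n) \<rho>"
    and supp: "\<And>v. v \<in> mat_support \<rho> \<Longrightarrow> reindex_vec (m * n) (block_index n h \<pi>) v \<in> S"
    and pos: "positive_semidefinite (M * n) (id_tensor M n \<Phi> \<rho>)"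
  shows "mat_trace (reindex_mat (m * n) (block_index n h \<pi>) \<rho>) = 0"
proof (rule avoids_positive_trace_zero[OF \<Psi> S])
  note g = block_index_inj[OF h(1) \<pi>] block_index_image[OF h(2) \<pi>(2)]
  show "positive_semidefinite (m * n) (reindex_mat (m * n) (block_index n h \<pi>) \<rho>)"
    by (rule positive_semidefinite_reindex[OF g \<rho>])
  have "\<rho> \<in> carrier_mat (M * n) (M * n)"
    using \<rho> by (simp add: positive_semidefinite_iff hermitian_mat_iff)
  then show "mat_support (reindex_mat (m * n) (block_index n h \<pi>) \<rho>) \<subseteq> S"
    using mat_support_reindex[OF g] supp by blast
  show "positive_semidefinite (m * n)
      (id_tensor m n \<Psi> (reindex_mat (m * n) (block_index n h \<pi>) \<rho>))"
    using positive_semidefinite_reindex[OF g pos]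
      id_tensor_reindex[where \<Psi> = \<Psi> and \<Phi> = \<Phi>, OF h(2) \<pi>(2) \<Phi>] by simp
qed

lemma nu_at_superadditive:
  assumes \<Phi>: "linear_mat_map n \<Phi>"
  shows "nu_at n m \<Phi> + nu_at n k \<Phi> \<le> nu_at n (m + k) \<Phi>"
proof -
  obtain S1 where S1: "avoids_positive n m \<Phi> S1" "subspace_dim (m * n) S1 = nu_at n m \<Phi>"
    by (rule nu_at_attained)
  obtain S2 where S2: "avoids_positive n k \<Phi> S2" "subspace_dim (k * n) S2 = nu_at n k \<Phi>"
    by (rule nu_at_attained)
  have sub1: "S1 \<subseteq> carrier_vec (m * n)" and sub2: "S2 \<subseteq> carrier_vec (k * n)"
    and zero1: "0\<^sub>v (m * n) \<in> S1" and zero2: "0\<^sub>v (k * n) \<in> S2"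
    using S1 S2 by (auto simp: avoids_positive_def complex_subspace_iff)
  define g1 where "g1 = block_index n id id"
  define g2 where "g2 = block_index n (\<lambda>i. m + i) id"
  have g1: "g1 r = r" and g2: "g2 r = m * n + r" for r
    by (simp_all add: g1_def g2_def block_index_def algebra_simps)
  define N where "N = (m + k) * n"
  have N: "N = m * n + k * n"
    by (simp add: N_def algebra_simps)
  \<comment> \<open>The direct sum of \<open>S1\<close> and \<open>S2\<close>, described by its
    coordinate projections, so that the supports of the two compressions land in \<open>S1\<close>
    and \<open>S2\<close> at once.\<close>
  define S where "S = {v \<in> carrier_vec N. reindex_vec (m * n) g1 v \<in> S1 \<and> reindex_vec (k * n) g2 v \<in> S2}"
  have lin: "reindex_vec d g (v + w) = reindex_vec d g v + reindex_vec d g w"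
      "reindex_vec d g (c \<cdot>\<^sub>v v) = c \<cdot>\<^sub>v reindex_vec d g v"
    if "\<And>i. i < d \<Longrightarrow> g i < N" "v \<in> carrier_vec N" "w \<in> carrier_vec N" for v w d g c
    using that by (auto simp: reindex_vec_def)
  have lt: "g1 i < N" if "i < m * n" for i
    using that by (simp add: g1 N)
  have lt': "g2 i < N" if "i < k * n" for i
    using that by (simp add: g2 N)
  have zero: "reindex_vec (m * n) g1 (0\<^sub>v N) = 0\<^sub>v (m * n)"
      "reindex_vec (k * n) g2 (0\<^sub>v N) = 0\<^sub>v (k * n)"
    using lt lt' by (auto simp: reindex_vec_def)
  have S_sub: "complex_subspace N S"
    using S1(1) S2(1) lin[where g = g1, OF lt] lin[where g = g2, OF lt'] zero
    by (auto simp: complex_subspace_iff S_def avoids_positive_def)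
  \<comment> \<open>The first projection maps \<open>S\<close> onto \<open>S1\<close>; its kernel
    \<open>K\<close> is a copy of \<open>S2\<close>, whose dimension is bounded below through the
    second projection.\<close>
  define K where "K = {v \<in> S. reindex_vec (m * n) g1 v = 0\<^sub>v (m * n)}"
  have K_sub: "complex_subspace N K"
    and dim_S: "subspace_dim (m * n) (reindex_vec (m * n) g1 ` S) + subspace_dim N K = subspace_dim N S"
    unfolding K_def using subspace_rank_nullity[OF S_sub] lt by blast+
  have dim_K: "subspace_dim (k * n) (reindex_vec (k * n) g2 ` K) \<le> subspace_dim N K"
    using subspace_rank_nullity(3)[OF K_sub, of "k * n" g2] lt' by fastforce
  have "reindex_vec (m * n) g1 ` S = S1"
  proof
    show "S1 \<subseteq> reindex_vec (m * n) g1 ` S"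
    proof
      fix v assume v: "v \<in> S1"
      then have dim_v: "dim_vec v = m * n" using sub1 by auto
      \<comment> \<open>Extension of \<open>v\<close> by zero; its second projection is zero, which
        lies in \<open>S2\<close>.\<close>
      define v' where "v' = vec N (\<lambda>r. if r < m * n then v $ r else 0)"
      have "reindex_vec (m * n) g1 v' = v" "reindex_vec (k * n) g2 v' = 0\<^sub>v (k * n)"
        using dim_v by (auto simp: reindex_vec_def v'_def g1 g2 N)
      moreover have "v' \<in> carrier_vec N"
        by (simp add: v'_def)
      ultimately show "v \<in> reindex_vec (m * n) g1 ` S"
        using v zero2 by (intro image_eqI[of _ _ v']) (auto simp: S_def)
    qed
  qed (auto simp: S_def)
  moreover have "reindex_vec (k * n) g2 ` K = S2"
  proof
    show "S2 \<subseteq> reindex_vec (k * n) g2 ` K"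
    proof
      fix v assume v: "v \<in> S2"
      then have dim_v: "dim_vec v = k * n" using sub2 by auto
      define v' where "v' = vec N (\<lambda>r. if r < m * n then 0 else v $ (r - m * n))"
      have "reindex_vec (k * n) g2 v' = v" "reindex_vec (m * n) g1 v' = 0\<^sub>v (m * n)"
        using dim_v by (auto simp: reindex_vec_def v'_def g1 g2 N)
      moreover have "v' \<in> carrier_vec N"
        by (simp add: v'_def)
      ultimately show "v \<in> reindex_vec (k * n) g2 ` K"
        using v zero1 by (intro image_eqI[of _ _ v']) (auto simp: S_def K_def)
    qed
  qed (auto simp: S_def K_def)
  ultimately have dim: "nu_at n m \<Phi> + nu_at n k \<Phi> \<le> subspace_dim N S"
    using dim_S dim_K S1(2) S2(2) by simp
  have "avoids_positive n (m + k) \<Phi> S"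
    unfolding avoids_positive_def
  proof (intro conjI allI impI notI)
    show "complex_subspace ((m + k) * n) S"
      using S_sub by (simp add: N_def)
    fix \<rho> assume \<rho>: "density_mat ((m + k) * n) \<rho> \<and> mat_support \<rho> \<subseteq> S"
      and pos: "positive_semidefinite ((m + k) * n) (id_tensor (m + k) n \<Phi> \<rho>)"
    then have psd: "positive_semidefinite ((m + k) * n) \<rho>" and carr: "\<rho> \<in> carrier_mat N N"
      by (auto simp: density_mat_def positive_semidefinite_iff hermitian_mat_iff N_def)
    have comm: "\<Phi> (reindex_mat n id Y) = reindex_mat n id (\<Phi> Y)" if "Y \<in> carrier_mat n n" for Y
    proof -
      have id: "reindex_mat n id Z = Z" if "Z \<in> carrier_mat n n" for Z
        using that by (auto simp: reindex_mat_def)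
      show ?thesis
        using \<Phi> that by (simp add: id linear_mat_map_iff)
    qed
    have "mat_trace (reindex_mat (m * n) g1 \<rho>) = 0"
      unfolding g1_def using \<rho> comm
      by (intro avoids_positive_reindex_trace[OF \<Phi> S1(1) _ _ _ _ _ psd _ pos])
        (auto simp: S_def g1_def)
    moreover have "mat_trace (reindex_mat (k * n) g2 \<rho>) = 0"
      unfolding g2_def using \<rho> comm
      by (intro avoids_positive_reindex_trace[OF \<Phi> S2(1) _ _ _ _ _ psd _ pos])
        (auto simp: S_def g2_def)
    \<comment> \<open>The diagonals of the two compressions together make up the diagonal of
      \<open>\<rho>\<close>, so its trace would be 0 instead of 1.\<close>
    moreover have "mat_trace \<rho> = mat_trace (reindex_mat (m * n) g1 \<rho>) + mat_trace (reindex_mat (k * n) g2 \<rho>)"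
    proof -
      have "(\<Sum>i<a + b. \<rho> $$ (i, i)) = (\<Sum>i<a. \<rho> $$ (i, i)) + (\<Sum>i<b. \<rho> $$ (a + i, a + i))" for a b
        by (induction b) (simp_all add: add.assoc)
      then show ?thesis
        using carr by (simp add: mat_trace_def reindex_mat_def g1 g2 N)
    qed
    ultimately show False
      using \<rho> by (simp add: density_mat_def)
  qed
  with dim show ?thesis
    using nu_at_ge[of n "m + k" \<Phi> S] by (simp add: N_def)
qed

section \<open>Invariance under coordinate permutations\<close>

text \<open>An optimal \<open>S\<close> for \<open>\<Psi>\<close> is carried by
  \<open>\<pi>\<close>, acting in every block, to a subspace of the same dimension that is
  admissible for \<open>\<Phi>\<close>. Equality arises by applying this with the roles
  exchanged.\<close>

lemma nu_at_conjugate_le: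
  assumes \<Psi>: "linear_mat_map n \<Psi>"
    and \<pi>: "\<And>a. a < n \<Longrightarrow> \<pi> a < n" "\<And>a. a < n \<Longrightarrow> \<pi> (\<pi> a) = a"
    and \<Phi>: "\<And>Y. Y \<in> carrier_mat n n \<Longrightarrow> \<Psi> (reindex_mat n \<pi> Y) = reindex_mat n \<pi> (\<Phi> Y)"
  shows "nu_at n m \<Psi> \<le> nu_at n m \<Phi>"
proof -
  obtain S where S: "avoids_positive n m \<Psi> S" "subspace_dim (m * n) S = nu_at n m \<Psi>"
    by (rule nu_at_attained)
  then have S_sub: "complex_subspace (m * n) S" and S_carr: "S \<subseteq> carrier_vec (m * n)"
    and zero: "0\<^sub>v (m * n) \<in> S"
    by (auto simp: avoids_positive_def complex_subspace_iff)
  define g where "g = block_index n id \<pi>"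
  have g: "g r < m * n" "g (g r) = r" if "r < m * n" for r
  proof -
    have n: "n > 0" using that by (cases n) auto
    show "g r < m * n"
      using that n \<pi>(1) unfolding g_def block_index_def
      by (auto intro!: block_index_less simp: less_mult_imp_div_less)
    show "g (g r) = r"
      using n \<pi> by (simp add: g_def block_index_def)
  qed
  have invol: "reindex_vec (m * n) g (reindex_vec (m * n) g v) = v" if "v \<in> carrier_vec (m * n)" for v
    using that g by (auto simp: reindex_vec_def)
  define S' where "S' = reindex_vec (m * n) g ` S"
  have S'_sub: "complex_subspace (m * n) S'"
    and dim_S': "subspace_dim (m * n) S' + subspace_dim (m * n) {v \<in> S. reindex_vec (m * n) g v = 0\<^sub>v (m * n)}
      = subspace_dim (m * n) S"
    unfolding S'_def using subspace_rank_nullity[OF S_sub] g(1) by blast+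
  \<comment> \<open>The kernel is trivial because \<open>g\<close> is an involution, so the
    dimension is preserved.\<close>
  have "{v \<in> S. reindex_vec (m * n) g v = 0\<^sub>v (m * n)} = {0\<^sub>v (m * n)}"
  proof -
    have rz: "reindex_vec (m * n) g (0\<^sub>v (m * n)) = 0\<^sub>v (m * n)"
      using g by (auto simp: reindex_vec_def)
    have "v = 0\<^sub>v (m * n)" if "v \<in> S" "reindex_vec (m * n) g v = 0\<^sub>v (m * n)" for v
      using invol[of v] that S_carr rz by auto
    with rz zero show ?thesis by auto
  qed
  with dim_S' S(2) have dim: "subspace_dim (m * n) S' = nu_at n m \<Psi>"
    by (simp add: subspace_dim_zero)
  have "avoids_positive n m \<Phi> S'"
    unfolding avoids_positive_def
  proof (intro conjI allI impI notI)
    show "complex_subspace (m * n) S'"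
      by (rule S'_sub)
    fix \<rho> assume \<rho>: "density_mat (m * n) \<rho> \<and> mat_support \<rho> \<subseteq> S'"
      and pos: "positive_semidefinite (m * n) (id_tensor m n \<Phi> \<rho>)"
    then have psd: "positive_semidefinite (m * n) \<rho>" and carr: "\<rho> \<in> carrier_mat (m * n) (m * n)"
      by (auto simp: density_mat_def positive_semidefinite_iff hermitian_mat_iff)
    have "inj_on \<pi> {..<n}"
      using \<pi> by (metis inj_on_inverseI lessThan_iff)
    moreover have "reindex_vec (m * n) g v \<in> S" if "v \<in> mat_support \<rho>" for v
    proof -
      from that \<rho> obtain u where "u \<in> S" "v = reindex_vec (m * n) g u"
        unfolding S'_def by blast
      then show ?thesis
        using invol[of u] S_carr by auto
    qed
    ultimately have "mat_trace (reindex_mat (m * n) g \<rho>) = 0"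
      unfolding g_def using \<pi> \<Phi>
      by (intro avoids_positive_reindex_trace[OF \<Psi> S(1) _ _ _ _ _ psd _ pos])
        (auto simp: g_def)
    \<comment> \<open>Permuting the coordinates keeps the trace, which is 1.\<close>
    moreover have "(\<Sum>i<m * n. \<rho> $$ (g i, g i)) = (\<Sum>i<m * n. \<rho> $$ (i, i))"
      using g by (intro sum.reindex_bij_witness[of _ g g]) auto
    ultimately show False
      using \<rho> carr by (simp add: density_mat_def mat_trace_def reindex_mat_def)
  qed
  with dim show ?thesis
    using nu_at_ge by metis
qed

section \<open>Adjoint maps\<close>

text \<open>The witnesses are half of \<open>A\<close> plus its adjoint, and \<open>A\<close> minus
  its adjoint over \<open>2 * \<i>\<close>. They extend identities known for Hermitian matrices to
  all matrices by linearity.\<close>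

lemma hermitian_decomposition:
  assumes A: "A \<in> carrier_mat n n"
  obtains H K where "hermitian_mat n H" "hermitian_mat n K" "A = H + \<i> \<cdot>\<^sub>m K"
proof
  let ?H = "mat n n (\<lambda>(i, j). (A $$ (i, j) + cnj (A $$ (j, i))) / 2)"
  let ?K = "mat n n (\<lambda>(i, j). (A $$ (i, j) - cnj (A $$ (j, i))) / (2 * \<i>))"
  show "hermitian_mat n ?H" "hermitian_mat n ?K"
    by (auto simp: hermitian_mat_iff field_simps)
  show "A = ?H + \<i> \<cdot>\<^sub>m ?K"
    using A by (auto simp: field_simps intro!: eq_matI)
qed

lemma mat_trace_mult:
  assumes "A \<in> carrier_mat n n" "B \<in> carrier_mat n n"
  shows "mat_trace (A * B) = (\<Sum>i<n. \<Sum>j<n. A $$ (i, j) * B $$ (j, i))"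
  using assms by (auto simp: mat_trace_def scalar_prod_def lessThan_atLeast0 intro!: sum.cong)

text \<open>Hermitian matrices span all matrices over the complex numbers, so the identity extends
  to matrix units, which read off single entries.\<close>

lemma mat_trace_hermitian_separates:
  assumes A: "A \<in> carrier_mat n n" and B: "B \<in> carrier_mat n n"
    and eq: "\<And>Y. hermitian_mat n Y \<Longrightarrow> mat_trace (A * Y) = mat_trace (B * Y)"
  shows "A = B"
proof (rule eq_matI)
  fix k l assume "k < dim_row B" "l < dim_col B"
  then have kl: "k < n" "l < n"
    using B by auto
  \<comment> \<open>The unit sits at the transposed position \<open>(l, k)\<close>, so that the
    trace of \<open>C * E\<close> is the entry of \<open>C\<close> at \<open>(k, l)\<close>.\<close>
  define E :: "complex mat" where "E = mat n n (\<lambda>(i, j). of_bool (i = l \<and> j = k))"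
  have E: "E \<in> carrier_mat n n"
    by (simp add: E_def)
  obtain H K where HK: "hermitian_mat n H" "hermitian_mat n K" "E = H + \<i> \<cdot>\<^sub>m K"
    using hermitian_decomposition[OF E] .
  have split: "mat_trace (C * E) = mat_trace (C * H) + \<i> * mat_trace (C * K)"
    if C: "C \<in> carrier_mat n n" for C
  proof -
    have HK_carr: "H \<in> carrier_mat n n" "K \<in> carrier_mat n n"
      using HK by (simp_all add: hermitian_mat_iff)
    have "mat_trace (C * E) = (\<Sum>i<n. \<Sum>j<n. C $$ (i, j) * H $$ (j, i) + \<i> * (C $$ (i, j) * K $$ (j, i)))"
      unfolding mat_trace_mult[OF C E] using HK_carr by (simp add: HK(3) algebra_simps)
    also have "\<dots> = mat_trace (C * H) + \<i> * mat_trace (C * K)"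
      unfolding mat_trace_mult[OF C HK_carr(1)] mat_trace_mult[OF C HK_carr(2)]
      by (simp add: sum.distrib sum_distrib_left)
    finally show ?thesis .
  qed
  have pick: "mat_trace (C * E) = C $$ (k, l)" if C: "C \<in> carrier_mat n n" for C
  proof -
    have "mat_trace (C * E) = (\<Sum>i<n. \<Sum>j<n. if i = k then (if j = l then C $$ (i, j) else 0) else 0)"
      unfolding mat_trace_mult[OF C E] by (intro sum.cong) (auto simp: E_def)
    also have "\<dots> = (\<Sum>i<n. if i = k then C $$ (i, l) else 0)"
      using kl by (intro sum.cong) auto
    also have "\<dots> = C $$ (k, l)"
      using kl by simp
    finally show ?thesis .
  qed
  show "A $$ (k, l) = B $$ (k, l)"
    using pick[OF A] pick[OF B] split[OF A] split[OF B] eq[OF HK(1)] eq[OF HK(2)] by simp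
qed (use A B in auto)

text \<open>Uniqueness behind the definite description: two candidates agree on Hermitian matrices
  because traces separate, on all of \<open>carrier_mat n n\<close> by linearity, and elsewhere by
  extensionality.\<close>

lemma adjoint_map_eqI:
  assumes \<Psi>: "linear_mat_map n \<Psi>" "\<Psi> \<in> extensional (carrier_mat n n)"
    and adj: "\<And>X Y. hermitian_mat n X \<Longrightarrow> hermitian_mat n Y \<Longrightarrow>
      mat_trace (X * \<Phi> Y) = mat_trace (\<Psi> X * Y)"
  shows "adjoint_map n \<Phi> = \<Psi>"
  unfolding adjoint_map_def
proof (rule the_equality)
  fix \<Psi>' assume \<Psi>': "linear_mat_map n \<Psi>' \<and> \<Psi>' \<in> extensional (carrier_mat n n) \<and>
     (\<forall>X Y. hermitian_mat n X \<longrightarrow> hermitian_mat n Y \<longrightarrow> mat_trace (X * \<Phi> Y) = mat_trace (\<Psi>' X * Y))"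
  have herm: "\<Psi>' X = \<Psi> X" if "hermitian_mat n X" for X
  proof (rule mat_trace_hermitian_separates)
    have "X \<in> carrier_mat n n"
      using that by (simp add: hermitian_mat_iff)
    then show "\<Psi>' X \<in> carrier_mat n n" "\<Psi> X \<in> carrier_mat n n"
      using \<Psi> \<Psi>' by (simp_all add: linear_mat_map_iff)
    show "mat_trace (\<Psi>' X * Y) = mat_trace (\<Psi> X * Y)" if "hermitian_mat n Y" for Y
      using \<Psi>' adj \<open>hermitian_mat n X\<close> that by metis
  qed
  have "\<Psi>' X = \<Psi> X" if X: "X \<in> carrier_mat n n" for X
  proof -
    obtain H K where HK: "hermitian_mat n H" "hermitian_mat n K" "X = H + \<i> \<cdot>\<^sub>m K"
      using hermitian_decomposition[OF X] .
    then have "H \<in> carrier_mat n n" "K \<in> carrier_mat n n"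
      by (simp_all add: hermitian_mat_iff)
    then have F: "F X = F H + \<i> \<cdot>\<^sub>m F K" if "linear_mat_map n F" for F
      using that by (simp add: HK(3) linear_mat_map_iff)
    show ?thesis
      using F[of \<Psi>] F[of \<Psi>'] \<Psi> \<Psi>' herm[OF HK(1)] herm[OF HK(2)] by simp
  qed
  then show "\<Psi>' = \<Psi>"
    using \<Psi> \<Psi>' by (intro extensionalityI[of _ "carrier_mat n n"]) auto
qed (use \<Psi> adj in blast)

lemma linear_mat_map_conjugate:
  assumes \<Phi>: "linear_mat_map n \<Phi>" and \<pi>: "\<And>a. a < n \<Longrightarrow> \<pi> a < n"
  shows "linear_mat_map n (\<lambda>X\<in>carrier_mat n n. reindex_mat n \<pi> (\<Phi> (reindex_mat n \<pi> X)))"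
proof -
  have add: "reindex_mat n \<pi> (A + B) = reindex_mat n \<pi> A + reindex_mat n \<pi> B"
    and smult: "reindex_mat n \<pi> (c \<cdot>\<^sub>m A) = c \<cdot>\<^sub>m reindex_mat n \<pi> A"
    if "A \<in> carrier_mat n n" "B \<in> carrier_mat n n" for A B c
    using that \<pi> by (auto simp: reindex_mat_def)
  show ?thesis
    using \<Phi> by (simp add: linear_mat_map_iff add smult)
qed

section \<open>The Choi map\<close>

lemma choi_map_carrier [simp]: "choi_map X \<in> carrier_mat 3 3"
  by (rule carrier_matI) (simp_all add: choi_map_def mat_of_rows_list_def)

lemma less_3_iff: "i < 3 \<longleftrightarrow> i = 0 \<or> i = 1 \<or> i = (2::nat)"
  by auto

lemma choi_map_index:
  assumes "i < 3" "j < 3"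
  shows "choi_map X $$ (i, j) =
    (if i = j then X $$ (i, i) + X $$ ((i + 1) mod 3, (i + 1) mod 3) else - (X $$ (i, j)))"
  using assms unfolding less_3_iff
  by (elim disjE) (simp_all add: choi_map_def mat_of_rows_list_def numeral_2_eq_2)

lemma linear_choi_map: "linear_mat_map 3 choi_map"
  using choi_map_hermiticity_preserving by (simp add: hermiticity_preserving_def)

text \<open>The transposition of the first and the third coordinate; truncated subtraction keeps all
  values below 3.\<close>

definition swap_02 :: "nat \<Rightarrow> nat" where
  "swap_02 a = 2 - a"

text \<open>Passing to the adjoint turns the cyclic shift \<open>i + 1\<close> on the diagonal into
  \<open>i - 1\<close>, that is \<open>i + 2\<close> modulo 3, and exchanging the outer coordinates
  reverses the cycle in the same way. The restriction matches the extensionality in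
  \<open>adjoint_map\<close>.\<close>

lemma adjoint_choi_map:
  "adjoint_map 3 choi_map =
     restrict (\<lambda>X. reindex_mat 3 swap_02 (choi_map (reindex_mat 3 swap_02 X))) (carrier_mat 3 3)"
    (is "_ = restrict ?\<Psi> _")
proof (rule adjoint_map_eqI)
  have index: "?\<Psi> X $$ (i, j) =
      (if i = j then X $$ (i, i) + X $$ ((i + 2) mod 3, (i + 2) mod 3) else - (X $$ (i, j)))"
    if "i < 3" "j < 3" for X i j
    using that unfolding less_3_iff
    by (elim disjE) (simp_all add: reindex_mat_def swap_02_def choi_map_index numeral_2_eq_2)
  show "linear_mat_map 3 (restrict ?\<Psi> (carrier_mat 3 3))"
    using linear_choi_map by (rule linear_mat_map_conjugate) (simp add: swap_02_def)
  show "restrict ?\<Psi> (carrier_mat 3 3) \<in> extensional (carrier_mat 3 3)"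
    by simp
  fix X Y assume "hermitian_mat 3 X" "hermitian_mat 3 Y"
  then have XY: "X \<in> carrier_mat 3 3" "Y \<in> carrier_mat 3 3"
    by (simp_all add: hermitian_mat_iff)
  have sum3: "(\<Sum>i<3. f i) = f 0 + f 1 + f 2" for f :: "nat \<Rightarrow> complex"
    by (simp add: numeral_3_eq_3 numeral_2_eq_2)
  show "mat_trace (X * choi_map Y) = mat_trace (restrict ?\<Psi> (carrier_mat 3 3) X * Y)"
    using XY by (simp add: mat_trace_mult[of _ 3] sum3 index choi_map_index algebra_simps numeral_2_eq_2)
qed

text \<open>Since \<open>swap_02\<close> is an involution, conjugation by it relates the two maps in
  both directions, and \<open>nu_at_conjugate_le\<close> applies twice.\<close>

lemma nu_at_adjoint_choi_map: "nu_at 3 m choi_map = nu_at 3 m (adjoint_map 3 choi_map)"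
proof (rule antisym)
  have invol: "reindex_mat 3 swap_02 (reindex_mat 3 swap_02 Y) = Y" if "Y \<in> carrier_mat 3 3" for Y
    using that by (auto simp: reindex_mat_def swap_02_def)
  have lt: "swap_02 a < 3" for a
    by (simp add: swap_02_def)
  have idem: "swap_02 (swap_02 a) = a" if "a < 3" for a
    using that by (simp add: swap_02_def)
  have adj: "adjoint_map 3 choi_map X = reindex_mat 3 swap_02 (choi_map (reindex_mat 3 swap_02 X))"
    if "X \<in> carrier_mat 3 3" for X
    using that by (simp add: adjoint_choi_map)
  have "linear_mat_map 3 (adjoint_map 3 choi_map)"
    unfolding adjoint_choi_map
    using linear_choi_map by (rule linear_mat_map_conjugate) (simp add: swap_02_def)
  then show "nu_at 3 m (adjoint_map 3 choi_map) \<le> nu_at 3 m choi_map"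
    by (rule nu_at_conjugate_le[where \<pi> = swap_02]) (simp_all add: lt idem adj invol)
  show "nu_at 3 m choi_map \<le> nu_at 3 m (adjoint_map 3 choi_map)"
    by (rule nu_at_conjugate_le[OF linear_choi_map, where \<pi> = swap_02]) (simp_all add: lt idem adj invol)
qed

text \<open>On \<open>v\<close> with vanishing third components, the output of the Choi map splits into three
  rank-one terms: the minus signs are absorbed by negating the second components of \<open>v\<close>, and
  two diagonal terms are left over.\<close>

lemma choi_map_positive_on_rank_one:
  fixes v :: "nat \<Rightarrow> complex"
  assumes v: "\<And>i. i < m \<Longrightarrow> v (i * 3 + 2) = 0"
  shows "positive_semidefinite (m * 3)
    (id_tensor m 3 choi_map (mat (m * 3) (m * 3) (\<lambda>(r, s). v r * cnj (v s))))"
proof -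
  define x where "x r = (if r mod 3 = 1 then - v r else v r)" for r
  \<comment> \<open>\<open>y\<close> carries the second component of each block to the first
    position and \<open>z\<close> the first to the third; they supply the summands that the Choi map
    adds in these diagonal entries. The summand added in the middle entry comes from third
    components and vanishes.\<close>
  define y where "y r = (if r mod 3 = 0 then v (r + 1) else 0)" for r
  define z where "z r = (if r mod 3 = 2 then v (r - 2) else 0)" for r
  let ?X = "mat (m * 3) (m * 3) (\<lambda>(r, s). v r * cnj (v s))"
  let ?R = "\<lambda>u. mat (m * 3) (m * 3) (\<lambda>(r, s). u r * cnj (u s)) :: complex mat"
  have "id_tensor m 3 choi_map ?X = ?R x + ?R y + ?R z"
  proof (intro eq_matI)
    fix r s assume "r < dim_row (?R x + ?R y + ?R z)" "s < dim_col (?R x + ?R y + ?R z)"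
    then have rs: "r < m * 3" "s < m * 3" by simp_all
    define i a j b where "i = r div 3" and "a = r mod 3" and "j = s div 3" and "b = s mod 3"
    have r: "r = i * 3 + a" and s: "s = j * 3 + b"
      by (simp_all add: i_def a_def j_def b_def)
    have ij: "i < m" "j < m" "a < 3" "b < 3"
      using rs by (simp_all add: i_def j_def a_def b_def less_mult_imp_div_less)
    have block: "tensor_block 3 ?X i j $$ (c, d) = v (i * 3 + c) * cnj (v (j * 3 + d))"
      if "c < 3" "d < 3" for c d
      using that ij by (simp add: tensor_block_def block_index_less)
    have mods: "Suc (k * 3) mod 3 = 1" "Suc (Suc (k * 3)) mod 3 = 2" for k :: nat
      by presburger+
    have "id_tensor m 3 choi_map ?X $$ (r, s) = choi_map (tensor_block 3 ?X i j) $$ (a, b)"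
      using rs by (simp add: id_tensor_def i_def j_def a_def b_def)
    also have "\<dots> = x r * cnj (x s) + y r * cnj (y s) + z r * cnj (z s)"
      using ij(3,4) v[OF ij(1)] v[OF ij(2)] unfolding r s less_3_iff
      by (elim disjE) (simp_all add: choi_map_index block x_def y_def z_def mods)
    also have "\<dots> = (?R x + ?R y + ?R z) $$ (r, s)"
      using rs by simp
    finally show "id_tensor m 3 choi_map ?X $$ (r, s) = (?R x + ?R y + ?R z) $$ (r, s)" .
  qed (simp_all add: id_tensor_def)
  then show ?thesis
    using positive_semidefinite_add positive_semidefinite_rank_one by presburger
qed

section \<open>Dimension bound for the Choi map\<close>

text \<open>Taking third components is injective on \<open>S\<close>, since a nonzero
  \<open>v\<close> in the kernel would give a rank-one matrix with positive semidefinite image; the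
  target has dimension \<open>m\<close>.\<close>

lemma avoids_positive_choi_map_dim:
  assumes S: "avoids_positive 3 m choi_map S"
  shows "subspace_dim (m * 3) S \<le> m"
proof -
  have S_sub: "complex_subspace (m * 3) S" and S_carr: "S \<subseteq> carrier_vec (m * 3)"
    and zero: "0\<^sub>v (m * 3) \<in> S"
    using S by (auto simp: avoids_positive_def complex_subspace_iff)
  \<comment> \<open>Indices count from 0, so offset 2 is the third coordinate of block
    \<open>i\<close>.\<close>
  define g where "g = (\<lambda>i::nat. i * 3 + 2)"
  have g: "g i < m * 3" if "i < m" for i
    using that by (simp add: g_def)
  have "v = 0\<^sub>v (m * 3)" if v: "v \<in> S" and ker: "reindex_vec m g v = 0\<^sub>v m" for v
  proof -
    have carr: "v \<in> carrier_vec (m * 3)"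
      using v S_carr by blast
    have third: "v $ (i * 3 + 2) = 0" if "i < m" for i
      using arg_cong[OF ker, of "\<lambda>w. w $ i"] that by (simp add: reindex_vec_def g_def)
    define X where "X = mat (m * 3) (m * 3) (\<lambda>(r, s). v $ r * cnj (v $ s))"
    have supp: "mat_support X \<subseteq> S"
    proof
      fix u assume "u \<in> mat_support X"
      then obtain w where w: "w \<in> carrier_vec (m * 3)" "u = X *\<^sub>v w"
        by (auto simp: mat_support_def X_def)
      \<comment> \<open>Every vector in the range of \<open>X\<close> is a multiple of
        \<open>v\<close> and thus lies in \<open>S\<close>.\<close>
      have "u = (\<Sum>s<m * 3. cnj (v $ s) * w $ s) \<cdot>\<^sub>v v"
      proof (rule eq_vecI)
        fix r assume "r < dim_vec ((\<Sum>s<m * 3. cnj (v $ s) * w $ s) \<cdot>\<^sub>v v)"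
        then have r: "r < m * 3"
          using carr by simp
        have "u $ r = (\<Sum>s<m * 3. v $ r * cnj (v $ s) * w $ s)"
          using r w by (simp add: X_def scalar_prod_def lessThan_atLeast0)
        also have "\<dots> = v $ r * (\<Sum>s<m * 3. cnj (v $ s) * w $ s)"
          by (simp add: sum_distrib_left mult.assoc)
        finally show "u $ r = ((\<Sum>s<m * 3. cnj (v $ s) * w $ s) \<cdot>\<^sub>v v) $ r"
          using r carr by simp
      qed (use w carr in \<open>simp add: X_def\<close>)
      then show "u \<in> S"
        using S_sub v by (simp add: complex_subspace_iff)
    qed
    have "mat_trace X = 0"
      using avoids_positive_trace_zero[OF linear_choi_map S _ supp]
        choi_map_positive_on_rank_one[of m "($) v"] third
        positive_semidefinite_rank_one[of "m * 3" "($) v"]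
      by (simp add: X_def)
    \<comment> \<open>The trace is the squared norm of \<open>v\<close>, so its vanishing kills
      \<open>v\<close>.\<close>
    moreover have "mat_trace X = of_real (\<Sum>r<m * 3. (cmod (v $ r))\<^sup>2)"
      by (simp add: mat_trace_def X_def complex_norm_square[symmetric])
    ultimately have "(\<Sum>r<m * 3. (cmod (v $ r))\<^sup>2) = 0"
      by (metis of_real_eq_0_iff)
    then have "\<forall>r<m * 3. v $ r = 0"
      by (simp add: sum_nonneg_eq_0_iff)
    then show ?thesis
      using carr by (intro eq_vecI) auto
  qed
  moreover have "reindex_vec m g (0\<^sub>v (m * 3)) = 0\<^sub>v m"
    using g by (auto simp: reindex_vec_def)
  ultimately have "{v \<in> S. reindex_vec m g v = 0\<^sub>v m} = {0\<^sub>v (m * 3)}"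
    using zero by blast
  then have "subspace_dim (m * 3) S = subspace_dim m (reindex_vec m g ` S)"
    using subspace_rank_nullity(3)[OF S_sub, of m g] g by (simp add: subspace_dim_zero)
  also have "\<dots> \<le> m"
    using subspace_rank_nullity(1)[OF S_sub, of m g] g by (intro subspace_dim_le) auto
  finally show ?thesis .
qed

lemma nu_at_choi_map_le: "nu_at 3 m choi_map \<le> m"
  by (metis avoids_positive_choi_map_dim nu_at_attained)

theorem theorem3:
  fixes m :: nat
  assumes "m \<ge> 1"
  shows "(nu_at 3 m choi_map = nu_at 3 m (adjoint_map 3 choi_map) \<and>
          int (nu_at 3 m (adjoint_map 3 choi_map)) \<le> \<lceil>5 * real m / 3\<rceil> - 1) \<and>
         (nu 3 choi_map = nu 3 (adjoint_map 3 choi_map) \<and>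
          nu 3 (adjoint_map 3 choi_map) \<le> 5 / 3)"
proof (intro conjI)
  show "nu_at 3 m choi_map = nu_at 3 m (adjoint_map 3 choi_map)"
    by (rule nu_at_adjoint_choi_map)
  \<comment> \<open>Strictness comes from \<open>m \<ge> 1\<close>; by integrality the ceiling is
    then at least \<open>m + 1\<close>, which pays for the \<open>- 1\<close> in the bound.\<close>
  have "real m < 5 * real m / 3"
    using assms by simp
  then have "int m + 1 \<le> \<lceil>5 * real m / 3\<rceil>"
    by linarith
  then show "int (nu_at 3 m (adjoint_map 3 choi_map)) \<le> \<lceil>5 * real m / 3\<rceil> - 1"
    using nu_at_choi_map_le[of m] by (simp flip: nu_at_adjoint_choi_map)
  show "nu 3 choi_map = nu 3 (adjoint_map 3 choi_map)"
    by (simp add: nu_def nu_at_adjoint_choi_map)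
  \<comment> \<open>Convergence has to be known before \<open>lim\<close> can be bounded; the ratio
    bound 1 is stronger than 5/3.\<close>
  obtain L where "(\<lambda>m. real (nu_at 3 m choi_map) / real m) \<longlonglongrightarrow> L" "L \<le> 1"
    using nu_at_superadditive[OF linear_choi_map] nu_at_choi_map_le
    by (rule_tac superadditive_ratio_limit[of "\<lambda>m. real (nu_at 3 m choi_map)" 1])
      (simp_all flip: of_nat_add)
  then have "lim (\<lambda>m. real (nu_at 3 m choi_map) / real m) \<le> 1"
    by (simp add: limI)
  then show "nu 3 (adjoint_map 3 choi_map) \<le> 5 / 3"
    by (simp add: nu_def flip: nu_at_adjoint_choi_map)
qed

end
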